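(* Let $G$ be a group and $\precsim$ a quasi-order on $G$. Then $\precsim$ is a C-quasi-order if and only if the following three axioms are satisfied: $(CQ_1)$ for all $x\in G\setminus\{1\}$, $1\precnsim x$; $(CQ_2)$ for all $x,y\in G$, $x\precsim y\Leftrightarrow xy^{-1}\precsim y^{-1}$; $(CQ_3)$ for all $x,y,z\in G$, $x\precsim y\Leftrightarrow x^z\precsim y^z$, where $x^z:=zxz^{-1}$.
   Context: A quasi-order is a reflexive, transitive and total binary relation $\precsim$; $a\sim b$ means $a\precsim b\precsim a$, and $a\precnsim b$ means $a\precsim b$ and $a\nsim b$. A C-relation on a set is a ternary relation $C$ such that for all $x,y,z,w$: $C(x,y,z)\Rightarrow C(x,z,y)$; $C(x,y,z)\Rightarrow\neg C(y,x,z)$; $C(x,y,z)\Rightarrow C(w,y,z)\vee C(x,w,z)$; $x\neq y\Rightarrow C(x,y,y)$. On a group it is compatible if $C(x,y,z)$ implies $C(vxu,vyu,vzu)$ for all $x,y,z,u,v$. A C-quasi-order on a group $G$ is a quasi-order of the form $x\precsim y\Leftrightarrow\neg C(x,y,1)$, where $C$ is a compatible C-relation on $G$. *)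

theory Defs
  imports "HOL-Algebra.Group"
begin

definition quasi_order_on :: "'a set \<Rightarrow> 'a rel \<Rightarrow> bool" where
  "quasi_order_on A r \<longleftrightarrow> preorder_on A r \<and> total_on A r"

definition qo_equiv :: "'a rel \<Rightarrow> 'a \<Rightarrow> 'a \<Rightarrow> bool" where
  "qo_equiv r a b \<longleftrightarrow> (a, b) \<in> r \<and> (b, a) \<in> r"

definition qo_less :: "'a rel \<Rightarrow> 'a \<Rightarrow> 'a \<Rightarrow> bool" where
  "qo_less r a b \<longleftrightarrow> (a, b) \<in> r \<and> \<not> qo_equiv r a b"

text \<open>A ternary relation on \<open>A\<close> is given by a predicate on the ambient type; its values
  on triples not contained in \<open>A\<close> are irrelevant.\<close>

definition C_relation_on :: "'a set \<Rightarrow> ('a \<Rightarrow> 'a \<Rightarrow> 'a \<Rightarrow> bool) \<Rightarrow> bool" where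
  "C_relation_on A C \<longleftrightarrow>
     (\<forall>x\<in>A. \<forall>y\<in>A. \<forall>z\<in>A. C x y z \<longrightarrow> C x z y) \<and>
     (\<forall>x\<in>A. \<forall>y\<in>A. \<forall>z\<in>A. C x y z \<longrightarrow> \<not> C y x z) \<and>
     (\<forall>x\<in>A. \<forall>y\<in>A. \<forall>z\<in>A. \<forall>w\<in>A. C x y z \<longrightarrow> C w y z \<or> C x w z) \<and>
     (\<forall>x\<in>A. \<forall>y\<in>A. x \<noteq> y \<longrightarrow> C x y y)"

definition compatible_on_group ::
    "('a, 'm) monoid_scheme \<Rightarrow> ('a \<Rightarrow> 'a \<Rightarrow> 'a \<Rightarrow> bool) \<Rightarrow> bool" where
  "compatible_on_group G C \<longleftrightarrow>
     (\<forall>x\<in>carrier G. \<forall>y\<in>carrier G. \<forall>z\<in>carrier G. \<forall>u\<in>carrier G. \<forall>v\<in>carrier G.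
        C x y z \<longrightarrow> C (v \<otimes>\<^bsub>G\<^esub> x \<otimes>\<^bsub>G\<^esub> u) (v \<otimes>\<^bsub>G\<^esub> y \<otimes>\<^bsub>G\<^esub> u) (v \<otimes>\<^bsub>G\<^esub> z \<otimes>\<^bsub>G\<^esub> u))"

definition C_quasi_order :: "('a, 'm) monoid_scheme \<Rightarrow> 'a rel \<Rightarrow> bool" where
  "C_quasi_order G r \<longleftrightarrow>
     quasi_order_on (carrier G) r \<and>
     (\<exists>C. C_relation_on (carrier G) C \<and> compatible_on_group G C \<and>
        (\<forall>x\<in>carrier G. \<forall>y\<in>carrier G. (x, y) \<in> r \<longleftrightarrow> \<not> C x y \<one>\<^bsub>G\<^esub>))"

definition conjugate :: "('a, 'm) monoid_scheme \<Rightarrow> 'a \<Rightarrow> 'a \<Rightarrow> 'a" where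
  "conjugate G x z = z \<otimes>\<^bsub>G\<^esub> x \<otimes>\<^bsub>G\<^esub> inv\<^bsub>G\<^esub> z"

end

theory Submission
  imports Defs
begin

text \<open>A compatible C-relation is determined by its values at \<open>z = 1\<close>, since \<open>C x y z\<close> is
  equivalent to \<open>C (x z\<inverse>) (y z\<inverse>) 1\<close>. Conversely, a quasi-order satisfying the axioms
  yields the C-relation saying that \<open>x z\<inverse>\<close> is not below \<open>y z\<inverse>\<close>. Under this correspondence
  \<open>CQ\<^sub>1\<close> matches \<open>C x y y\<close> for distinct \<open>x\<close>, \<open>y\<close>; \<open>CQ\<^sub>2\<close> matches the symmetry of \<open>C\<close>
  in its last two arguments; and \<open>CQ\<^sub>3\<close> matches compatibility with left multiplication.\<close>

text \<open>\<open>total_on\<close> compares only distinct elements; reflexivity settles the case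
  \<open>a = b\<close>.\<close>

lemma quasi_order_on_cases:
  assumes "quasi_order_on A r" "a \<in> A" "b \<in> A" "(a, b) \<notin> r"
  shows "(b, a) \<in> r"
  using assms
  by (cases "a = b") (auto simp: quasi_order_on_def preorder_on_def total_on_def dest: refl_onD)

text \<open>Translations are invertible: the converse is compatibility again, applied with the
  inverses of \<open>v\<close> and \<open>u\<close>.\<close>

lemma compatible_on_group_iff:
  assumes "group G" "compatible_on_group G C"
    and [simp]: "x \<in> carrier G" "y \<in> carrier G" "z \<in> carrier G" "u \<in> carrier G" "v \<in> carrier G"
  shows "C (v \<otimes>\<^bsub>G\<^esub> x \<otimes>\<^bsub>G\<^esub> u) (v \<otimes>\<^bsub>G\<^esub> y \<otimes>\<^bsub>G\<^esub> u) (v \<otimes>\<^bsub>G\<^esub> z \<otimes>\<^bsub>G\<^esub> u) \<longleftrightarrow> C x y z"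
proof
  interpret group G by fact
  assume C: "C (v \<otimes>\<^bsub>G\<^esub> x \<otimes>\<^bsub>G\<^esub> u) (v \<otimes>\<^bsub>G\<^esub> y \<otimes>\<^bsub>G\<^esub> u) (v \<otimes>\<^bsub>G\<^esub> z \<otimes>\<^bsub>G\<^esub> u)"
  have cancel: "inv\<^bsub>G\<^esub> v \<otimes>\<^bsub>G\<^esub> (v \<otimes>\<^bsub>G\<^esub> w \<otimes>\<^bsub>G\<^esub> u) \<otimes>\<^bsub>G\<^esub> inv\<^bsub>G\<^esub> u = w" if "w \<in> carrier G" for w
    using that by (simp add: m_assoc) (simp flip: m_assoc)
  have "C (inv\<^bsub>G\<^esub> v \<otimes>\<^bsub>G\<^esub> (v \<otimes>\<^bsub>G\<^esub> x \<otimes>\<^bsub>G\<^esub> u) \<otimes>\<^bsub>G\<^esub> inv\<^bsub>G\<^esub> u)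
          (inv\<^bsub>G\<^esub> v \<otimes>\<^bsub>G\<^esub> (v \<otimes>\<^bsub>G\<^esub> y \<otimes>\<^bsub>G\<^esub> u) \<otimes>\<^bsub>G\<^esub> inv\<^bsub>G\<^esub> u)
          (inv\<^bsub>G\<^esub> v \<otimes>\<^bsub>G\<^esub> (v \<otimes>\<^bsub>G\<^esub> z \<otimes>\<^bsub>G\<^esub> u) \<otimes>\<^bsub>G\<^esub> inv\<^bsub>G\<^esub> u)"
    using assms(2) C unfolding compatible_on_group_def by simp
  then show "C x y z" by (simp only: cancel assms)
qed (use assms(2) in \<open>simp add: compatible_on_group_def\<close>)

lemma C_relation_onD:
  assumes "C_relation_on A C"
  shows "\<And>x y z. \<lbrakk>C x y z; x \<in> A; y \<in> A; z \<in> A\<rbrakk> \<Longrightarrow> C x z y"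
    and "\<And>x y z. \<lbrakk>C x y z; x \<in> A; y \<in> A; z \<in> A\<rbrakk> \<Longrightarrow> \<not> C y x z"
    and "\<And>x y. \<lbrakk>x \<noteq> y; x \<in> A; y \<in> A\<rbrakk> \<Longrightarrow> C x y y"
proof -
  note C = assms[unfolded C_relation_on_def]
  show "C x z y" if "C x y z" "x \<in> A" "y \<in> A" "z \<in> A" for x y z
    using that by (rule C[THEN conjunct1, rule_format, rotated -1])
  show "\<not> C y x z" if "C x y z" "x \<in> A" "y \<in> A" "z \<in> A" for x y z
    using that by (rule C[THEN conjunct2, THEN conjunct1, rule_format, rotated -1])
  show "C x y y" if "x \<noteq> y" "x \<in> A" "y \<in> A" for x y
    using that by (rule C[THEN conjunct2, THEN conjunct2, THEN conjunct2, rule_format, rotated -1])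
qed

lemma C_quasi_order_imp_axioms:
  fixes G (structure)
  assumes "group G" "C_quasi_order G r"
  shows "\<And>x. x \<in> carrier G - {\<one>} \<Longrightarrow> qo_less r \<one> x"
    and "\<And>x y. \<lbrakk>x \<in> carrier G; y \<in> carrier G\<rbrakk> \<Longrightarrow> (x, y) \<in> r \<longleftrightarrow> (x \<otimes> inv y, inv y) \<in> r"
    and "\<And>x y z. \<lbrakk>x \<in> carrier G; y \<in> carrier G; z \<in> carrier G\<rbrakk> \<Longrightarrow>
      (x, y) \<in> r \<longleftrightarrow> (conjugate G x z, conjugate G y z) \<in> r"
proof -
  interpret group G by fact
  obtain C where C: "C_relation_on (carrier G) C" and comp: "compatible_on_group G C"
    and r: "\<And>x y. x \<in> carrier G \<Longrightarrow> y \<in> carrier G \<Longrightarrow> (x, y) \<in> r \<longleftrightarrow> \<not> C x y \<one>"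
    using assms(2) unfolding C_quasi_order_def by blast
  note C_iff = compatible_on_group_iff[OF \<open>group G\<close> comp]
  show "qo_less r \<one> x" if "x \<in> carrier G - {\<one>}" for x
  proof -
    \<comment> \<open>The first fact makes \<open>x\<close> not below 1; by asymmetry it yields the
      second, which puts 1 below \<open>x\<close>.\<close>
    have "C x \<one> \<one>" "\<not> C \<one> x \<one>"
      using that C_relation_onD(2,3)[OF C] by auto
    then show ?thesis using that r[of x \<one>] r[of \<one> x] by (simp add: qo_less_def qo_equiv_def)
  qed
  show "(x, y) \<in> r \<longleftrightarrow> (x \<otimes> inv y, inv y) \<in> r" if xy: "x \<in> carrier G" "y \<in> carrier G" for x y
  proof -
    \<comment> \<open>Right translation by \<open>inv y\<close> moves 1 from the third place to the
      second; swapping the last two arguments then brings it back.\<close>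
    have "C x y \<one> \<longleftrightarrow> C (x \<otimes> inv y) \<one> (inv y)"
      using C_iff[of x y \<one> "inv y" \<one>] xy by simp
    also have "\<dots> \<longleftrightarrow> C (x \<otimes> inv y) (inv y) \<one>"
      using C_relation_onD(1)[OF C] xy by (meson inv_closed m_closed one_closed)
    finally show ?thesis using xy by (simp add: r)
  qed
  show "(x, y) \<in> r \<longleftrightarrow> (conjugate G x z, conjugate G y z) \<in> r"
    if "x \<in> carrier G" "y \<in> carrier G" "z \<in> carrier G" for x y z
    \<comment> \<open>Conjugation is a two-sided translation that fixes the third argument
      1.\<close>
    using C_iff[of x y \<one> "inv z" z] that by (simp add: r conjugate_def)
qed

lemma axioms_imp_C_quasi_order:
  fixes G (structure)
  assumes "group G" and qo: "quasi_order_on (carrier G) r"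
    and CQ1: "\<And>x. x \<in> carrier G - {\<one>} \<Longrightarrow> qo_less r \<one> x"
    and CQ2: "\<And>x y. \<lbrakk>x \<in> carrier G; y \<in> carrier G\<rbrakk> \<Longrightarrow> (x, y) \<in> r \<longleftrightarrow> (x \<otimes> inv y, inv y) \<in> r"
    and CQ3: "\<And>x y z. \<lbrakk>x \<in> carrier G; y \<in> carrier G; z \<in> carrier G\<rbrakk> \<Longrightarrow>
      (x, y) \<in> r \<longleftrightarrow> (conjugate G x z, conjugate G y z) \<in> r"
  shows "C_quasi_order G r"
proof -
  interpret group G by fact
  define C where "C x y z \<longleftrightarrow> (x \<otimes> inv z, y \<otimes> inv z) \<notin> r" for x y z
  have trans: "trans r"
    using qo by (simp add: quasi_order_on_def preorder_on_def)
  have symmetric: "C x z y"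
    if xyz: "x \<in> carrier G" "y \<in> carrier G" "z \<in> carrier G" and "C x y z" for x y z
  proof -
    \<comment> \<open>These identities show that \<open>CQ2\<close> turns the pair defining
      \<open>C x y z\<close> into the pair defining \<open>C x z y\<close>.\<close>
    have "inv (y \<otimes> inv z) = z \<otimes> inv y" "x \<otimes> inv z \<otimes> (z \<otimes> inv y) = x \<otimes> inv y"
      using xyz inv_solve_right[of "x \<otimes> inv z" x z]
      by (simp_all add: inv_mult_group flip: m_assoc)
    then show ?thesis
      using \<open>C x y z\<close> CQ2[of "x \<otimes> inv z" "y \<otimes> inv z"] xyz by (simp add: C_def)
  qed
  have asymmetric: "\<not> C y x z"
    if "x \<in> carrier G" "y \<in> carrier G" "z \<in> carrier G" "C x y z" for x y z
    \<comment> \<open>Asymmetry of \<open>C\<close> is totality of \<open>r\<close>.\<close>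
    using quasi_order_on_cases[OF qo, of "x \<otimes> inv z" "y \<otimes> inv z"] that by (simp add: C_def)
  \<comment> \<open>This is the contrapositive of transitivity of \<open>r\<close>, with the
    translate of \<open>w\<close> as the middle element.\<close>
  have cotransitive: "C w y z \<or> C x w z" if "C x y z" for w x y z
    using that transD[OF trans] by (auto simp: C_def)
  have irreflexive: "C x y y" if xy: "x \<in> carrier G" "y \<in> carrier G" "x \<noteq> y" for x y
  proof -
    \<comment> \<open>\<open>C x y y\<close> says that \<open>x \<otimes> inv y\<close> is not below
      1, which \<open>CQ1\<close> gives for every element other than 1.\<close>
    have "x \<otimes> inv y \<noteq> \<one>"
      using xy inv_equality[of x "inv y"] by auto
    then show ?thesis
      using CQ1[of "x \<otimes> inv y"] xy by (auto simp: C_def qo_less_def qo_equiv_def)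
  qed
  have "C_relation_on (carrier G) C"
    unfolding C_relation_on_def
    by (intro conjI ballI impI;
        (rule irreflexive | rule symmetric | rule asymmetric | rule cotransitive); assumption)
  moreover have "compatible_on_group G C"
    unfolding compatible_on_group_def
  proof (intro ballI impI)
    fix x y z u v
    assume xyz: "x \<in> carrier G" "y \<in> carrier G" "z \<in> carrier G" "u \<in> carrier G" "v \<in> carrier G"
      and "C x y z"
    \<comment> \<open>The right factor \<open>u\<close> cancels, so right translations preserve
      \<open>C\<close> by its very definition; the left factor \<open>v\<close> survives as a
      conjugation, which \<open>CQ3\<close> handles.\<close>
    have "v \<otimes> w \<otimes> u \<otimes> inv (v \<otimes> z \<otimes> u) = conjugate G (w \<otimes> inv z) v" if "w \<in> carrier G" for w
    proof -
      have "u \<otimes> (inv u \<otimes> (inv z \<otimes> inv v)) = inv z \<otimes> inv v"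
        using xyz by (simp flip: m_assoc)
      then show ?thesis
        using xyz that by (simp add: conjugate_def inv_mult_group m_assoc)
    qed
    then show "C (v \<otimes> x \<otimes> u) (v \<otimes> y \<otimes> u) (v \<otimes> z \<otimes> u)"
      using \<open>C x y z\<close> CQ3[of "x \<otimes> inv z" "y \<otimes> inv z" v] xyz by (simp add: C_def)
  qed
  moreover have "\<forall>x\<in>carrier G. \<forall>y\<in>carrier G. (x, y) \<in> r \<longleftrightarrow> \<not> C x y \<one>"
    by (simp add: C_def)
  ultimately show ?thesis
    unfolding C_quasi_order_def by (intro conjI exI[of _ C] qo)
qed

theorem proposition2p6:
  fixes G :: "('a, 'm) monoid_scheme" (structure)
    and r :: "'a rel"
  assumes "group G"
    and "quasi_order_on (carrier G) r"
  shows "C_quasi_order G r \<longleftrightarrow>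
    (\<forall>x \<in> carrier G - {\<one>}. qo_less r \<one> x) \<and>
    (\<forall>x \<in> carrier G. \<forall>y \<in> carrier G. (x, y) \<in> r \<longleftrightarrow> (x \<otimes> inv y, inv y) \<in> r) \<and>
    (\<forall>x \<in> carrier G. \<forall>y \<in> carrier G. \<forall>z \<in> carrier G.
       (x, y) \<in> r \<longleftrightarrow> (conjugate G x z, conjugate G y z) \<in> r)"
  (is "_ \<longleftrightarrow> ?axioms")
proof
  assume C: "C_quasi_order G r"
  show ?axioms
    using C_quasi_order_imp_axioms[OF assms(1) C] by (intro conjI ballI)
next
  assume ax: ?axioms
  show "C_quasi_order G r"
    by (rule axioms_imp_C_quasi_order[OF assms];
        (rule ax[THEN conjunct1, rule_format] | rule ax[THEN conjunct2, THEN conjunct1, rule_format]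
          | rule ax[THEN conjunct2, THEN conjunct2, rule_format]); assumption)
qed

end
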